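(* Let $G$ be a concurrent stochastic game in which all end components are trivial, i.e. every end component $E$ satisfies $E\subseteq W\cup T$. Then the over-approximation computed by the naive iteration $U^{k+1}=B(U^k)$ from $U^0$ converges to the value: $\lim_{k\to\infty}U^k=V$.
   Context: A concurrent stochastic game (CSG) is a tuple $G=(S,A_1,A_2,\Gamma_1,\Gamma_2,\delta,s_0,T)$: $S$ finite set of states; $A_1,A_2$ finite action sets of Player 1 (reachability) and Player 2 (safety); $\Gamma_i:S\to 2^{A_i}\setminus\{\emptyset\}$ enabled actions; $\delta:S\times A_1\times A_2\to\mathcal D(S)$ transition function; $s_0\in S$; $T\subseteq S$ target set. Memoryless strategies of Player 1 (resp. 2) map each $s$ to a distribution on $\Gamma_1(s)$ (resp. $\Gamma_2(s)$); a pair $(\rho,\sigma)$ induces a Markov chain and measures $\mathbb P^{\rho,\sigma}_s$. Value: $V(s)=\sup_\rho\inf_\sigma\mathbb P^{\rho,\sigma}_s(\Diamond T)$. $W=\{s:V(s)=0\}$. The paper assumes throughout (w.l.o.g.) that $T$ and $W$ are singletons and absorbing. Local strategies: $\Pi_1(s),\Pi_2(s)$ = distributions on $\Gamma_1(s),\Gamma_2(s)$. $\mathrm{Post}(s,\rho,\sigma)=\bigcup_{a\in\mathrm{supp}\rho,b\in\mathrm{supp}\sigma}\mathrm{supp}\,\delta(s,a,b)$. Valuations $v:S\to[0,1]$. Bellman operator: $B(v)(s)=\sup_{\rho\in\Pi_1(s)}\inf_{\sigma\in\Pi_2(s)}\sum_{a,b}\sum_{s'}\rho(a)\sigma(b)\delta(s,a,b)(s')v(s')$.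 $U^0(s)=0$ if $s\in W$, else $1$. End component: nonempty $X\subseteq S$ such that there exist local strategies $\rho_s,\sigma_s$ ($s\in X$) with $\mathrm{Post}(s,\rho_s,\sigma_s)\subseteq X$ for all $s\in X$ and any two states of $X$ are connected by a path inside $X$ following these successors. *)

theory Defs
  imports "HOL-Probability.Probability"
begin

section \<open>Discrete-time Markov chains\<close>

text \<open>
  The path measure of the chain with kernel \<open>K\<close> started in \<open>s\<close> is obtained from the
  Ionescu--Tulcea theorem.  The history passed to the \<open>n\<close>-th kernel is a function on
  \<open>{0..<n}\<close>; coordinate 0 of a path is its initial state.
\<close>

definition mc_kernel :: "('s \<Rightarrow> 's pmf) \<Rightarrow> 's \<Rightarrow> nat \<Rightarrow> (nat \<Rightarrow> 's) \<Rightarrow> 's measure" where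
  "mc_kernel K s n \<omega> =
     measure_pmf (case n of 0 \<Rightarrow> return_pmf s | Suc m \<Rightarrow> K (\<omega> m))"

lemma Ionescu_Tulcea_mc_kernel: "Ionescu_Tulcea (mc_kernel K s) (\<lambda>_. count_space UNIV)"
proof (rule Ionescu_Tulcea.intro)
  show "mc_kernel K s i \<in> measurable (PiM {0..<i} (\<lambda>_. count_space UNIV))
          (subprob_algebra (count_space UNIV))" for i
  proof (cases i)
    case 0
    then show ?thesis
      by (auto simp: mc_kernel_def[abs_def] measure_pmf_in_subprob_algebra)
  next
    case (Suc m)
    have comp: "(\<lambda>\<omega>. \<omega> m) \<in> measurable (PiM {0..<i} (\<lambda>_. count_space (UNIV :: 'a set)))
            (count_space UNIV)"
      using Suc by (intro measurable_component_singleton) auto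
    have ker: "(\<lambda>x. measure_pmf (K x)) \<in>
        measurable (count_space UNIV) (subprob_algebra (count_space UNIV))"
      by (simp add: measure_pmf_in_subprob_algebra)
    show ?thesis
      using measurable_compose[OF comp ker] Suc by (simp add: mc_kernel_def[abs_def])
  qed
next
  show "prob_space (mc_kernel K s i x)" for i x
    unfolding mc_kernel_def by (rule prob_space_measure_pmf)
qed

global_interpretation mc: Ionescu_Tulcea "mc_kernel K s" "\<lambda>_. count_space UNIV"
  for K :: "'s \<Rightarrow> 's pmf" and s :: 's
  by (rule Ionescu_Tulcea_mc_kernel)

definition mc_paths :: "('s \<Rightarrow> 's pmf) \<Rightarrow> 's \<Rightarrow> (nat \<Rightarrow> 's) measure" where
  "mc_paths K s = mc.PF.lim K s"

lemma sets_mc_paths: "sets (mc_paths K s) = sets (PiM UNIV (\<lambda>_. count_space UNIV))"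
  by (simp add: mc_paths_def)

lemma space_mc_paths: "space (mc_paths K s) = UNIV"
  using sets_eq_imp_space_eq[OF sets_mc_paths] by (simp add: space_PiM)

lemma mc_paths_component:
  "(\<lambda>\<omega>. \<omega> n) \<in> measurable (mc_paths K s) (count_space UNIV)"
  by (subst measurable_cong_sets[OF sets_mc_paths refl]) (rule measurable_component_singleton, simp)

lemma emeasure_mc_C_singleton:
  "emeasure (mc.C K s 0 (Suc n) (\<lambda>_. undefined)) {restrict x {0..<Suc n}} =
     ennreal (if x 0 = s then \<Prod>i<n. pmf (K (x i)) (x (Suc i)) else 0)"
proof -
  let ?M = "\<lambda>k. PiM {0..<k} (\<lambda>_. count_space (UNIV :: 'a set))"
  have singleton: "{restrict x {0..<k}} \<in> sets (?M k)" for k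
  proof -
    have "{restrict x {0..<k}} = (\<Pi>\<^sub>E i\<in>{0..<k}. {x i})"
      by (auto simp: PiE_def extensional_def fun_eq_iff Pi_def)
    then show ?thesis
      by (auto intro!: sets_PiM_I_finite)
  qed
  have step: "emeasure (mc.C K s 0 (Suc k) (\<lambda>_. undefined)) {restrict x {0..<Suc k}} =
      emeasure (mc.C K s 0 k (\<lambda>_. undefined)) {restrict x {0..<k}} *
      emeasure (mc_kernel K s k (restrict x {0..<k})) {x k}" for k
  proof -
    have u: "(\<lambda>_. undefined) \<in> space (?M 0)"
      by (simp add: space_PiM PiE_def extensional_def)
    note spC = mc.space_C[OF u, of K s k, simplified]
    note seC = mc.sets_C[OF u, of K s k, simplified]
    have eP: "emeasure (mc.eP K s k \<omega>) {restrict x {0..<Suc k}} =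
        emeasure (mc_kernel K s k (restrict x {0..<k})) {x k} *
        indicator {restrict x {0..<k}} \<omega>" if \<omega>: "\<omega> \<in> space (?M k)" for \<omega>
    proof -
      have ext_\<omega>: "\<omega> \<in> extensional {0..<k}"
        using \<omega> by (auto simp: space_PiM PiE_def)
      have upd: "fun_upd \<omega> k y = restrict x {0..<Suc k} \<longleftrightarrow> \<omega> = restrict x {0..<k} \<and> y = x k" for y
      proof
        assume eq: "fun_upd \<omega> k y = restrict x {0..<Suc k}"
        have "\<omega> i = restrict x {0..<k} i" for i
          using fun_cong[OF eq, of i] ext_\<omega> by (auto simp: extensional_def split: if_splits)
        moreover have "y = x k"
          using fun_cong[OF eq, of k] by simp
        ultimately show "\<omega> = restrict x {0..<k} \<and> y = x k"
          by auto
      qed (auto simp: fun_eq_iff)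
      have "(\<lambda>y. fun_upd \<omega> k y) -` {restrict x {0..<Suc k}} =
          (if \<omega> = restrict x {0..<k} then {x k} else {})"
        unfolding vimage_def singleton_iff upd by auto
      then show ?thesis
        using mc.emeasure_eP[OF \<omega> singleton[of "Suc k"], of K s]
        by (simp del: restrict_apply split: split_indicator)
    qed
    have "emeasure (mc.C K s 0 (Suc k) (\<lambda>_. undefined)) {restrict x {0..<Suc k}} =
        (\<integral>\<^sup>+\<omega>. emeasure (mc.eP K s k \<omega>) {restrict x {0..<Suc k}}
           \<partial>mc.C K s 0 k (\<lambda>_. undefined))"
      using mc.measurable_eP[of K s k] singleton[of "Suc k"] spC
      by (simp, subst emeasure_bind[where N = "?M (Suc k)"])
         (auto simp: measurable_cong_sets[OF seC refl])
    also have "\<dots> = (\<integral>\<^sup>+\<omega>. emeasure (mc_kernel K s k (restrict x {0..<k})) {x k} *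
        indicator {restrict x {0..<k}} \<omega> \<partial>mc.C K s 0 k (\<lambda>_. undefined))"
      by (intro nn_integral_cong eP) (simp add: spC)
    also have "\<dots> = emeasure (mc_kernel K s k (restrict x {0..<k})) {x k} *
        emeasure (mc.C K s 0 k (\<lambda>_. undefined)) {restrict x {0..<k}}"
      using singleton[of k] by (subst nn_integral_cmult_indicator) (auto simp: seC)
    finally show ?thesis
      by (simp add: mult.commute)
  qed
  show ?thesis
  proof (induction n)
    case 0
    have "emeasure (mc.C K s 0 0 (\<lambda>_. undefined)) {restrict x {0..<0}} = 1"
      using singleton[of 0] by (simp add: restrict_def)
    then show ?case
      unfolding step by (simp add: mc_kernel_def indicator_def)
  next
    case (Suc n)
    show ?case
      unfolding step[of "Suc n"] Suc.IH
      by (simp add: mc_kernel_def emeasure_pmf_single ennreal_mult'[symmetric] prod_nonneg)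
  qed
qed

lemma emeasure_mc_paths_cylinder:
  "emeasure (mc_paths K s) {\<omega>. \<forall>i\<le>n. \<omega> i = x i} =
     ennreal (if x 0 = s then \<Prod>i<n. pmf (K (x i)) (x (Suc i)) else 0)"
proof -
  let ?M = "\<lambda>_::nat. count_space (UNIV :: 'a set)"
  let ?X = "\<Pi>\<^sub>E i\<in>{0..<Suc n}. {x i}"
  have X: "?X = {restrict x {0..<Suc n}}"
    by (auto simp: PiE_def extensional_def fun_eq_iff Pi_def)
  have sets: "?X \<in> sets (PiM {0..<Suc n} ?M)"
    by (auto intro!: sets_PiM_I_finite)
  have "{\<omega>. \<forall>i\<le>n. \<omega> i = x i} = prod_emb UNIV ?M {0..<Suc n} ?X"
    by (auto simp: prod_emb_def PiE_def Pi_def less_Suc_eq_le)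
  then have "emeasure (mc_paths K s) {\<omega>. \<forall>i\<le>n. \<omega> i = x i} = emeasure (mc.CI K s {0..<Suc n}) ?X"
    unfolding mc_paths_def using mc.lim[of "{0..<Suc n}" ?X K s] sets by simp
  also have "\<dots> = emeasure (mc.C K s 0 (Suc n) (\<lambda>_. undefined)) ?X"
    using mc.emeasure_CI[of "{0..<Suc n}" "Suc n" ?X K s] sets
    by (simp add: prod_emb_PiE)
  finally show ?thesis
    unfolding X emeasure_mc_C_singleton .
qed

lemma prob_space_mc_paths: "prob_space (mc_paths K s)"
proof (rule prob_space_distrD)
  let ?M = "\<lambda>_::nat. count_space (UNIV :: 'a set)"
  show "(\<lambda>\<omega>. restrict \<omega> {}) \<in> measurable (mc_paths K s) (PiM {} ?M)"
    by (subst measurable_cong_sets[OF sets_mc_paths refl]) (rule measurable_restrict_subset, simp)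
  show "prob_space (distr (mc_paths K s) (PiM {} ?M) (\<lambda>\<omega>. restrict \<omega> {}))"
    unfolding mc_paths_def by (subst mc.distr_lim) (simp_all add: mc.PF.prob_space_P)
qed

lemma sets_reach_event: "{\<omega>. \<exists>n. \<omega> n \<in> T} \<in> sets (mc_paths K s)"
proof -
  have "(\<lambda>\<omega>. \<omega> n) -` T \<inter> space (mc_paths K s) \<in> sets (mc_paths K s)" for n
    by (rule measurable_sets[OF mc_paths_component]) simp
  then have "(\<Union>n. (\<lambda>\<omega>. \<omega> n) -` T) \<in> sets (mc_paths K s)"
    by (intro sets.countable_UN) (auto simp: space_mc_paths)
  also have "(\<Union>n. (\<lambda>\<omega>. \<omega> n) -` T) = {\<omega>. \<exists>n. \<omega> n \<in> T}"
    by auto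
  finally show ?thesis .
qed


section \<open>Concurrent stochastic games\<close>

record ('s, 'a, 'b) csg =
  states :: "'s set"
  actions1 :: "'a set"
  actions2 :: "'b set"
  enabled1 :: "'s \<Rightarrow> 'a set"
  enabled2 :: "'s \<Rightarrow> 'b set"
  transition :: "'s \<Rightarrow> 'a \<Rightarrow> 'b \<Rightarrow> 's pmf"
  initial :: 's
  target :: "'s set"

definition wf_csg :: "('s, 'a, 'b) csg \<Rightarrow> bool" where
  "wf_csg G \<longleftrightarrow>
     finite (states G) \<and> finite (actions1 G) \<and> finite (actions2 G) \<and>
     (\<forall>s\<in>states G. enabled1 G s \<subseteq> actions1 G \<and> enabled1 G s \<noteq> {}) \<and>
     (\<forall>s\<in>states G. enabled2 G s \<subseteq> actions2 G \<and> enabled2 G s \<noteq> {}) \<and>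
     (\<forall>s\<in>states G. \<forall>a\<in>actions1 G. \<forall>b\<in>actions2 G.
        set_pmf (transition G s a b) \<subseteq> states G) \<and>
     initial G \<in> states G \<and> target G \<subseteq> states G"

definition local_strategies1 :: "('s, 'a, 'b) csg \<Rightarrow> 's \<Rightarrow> 'a pmf set" where
  "local_strategies1 G s = {\<rho>. set_pmf \<rho> \<subseteq> enabled1 G s}"

definition local_strategies2 :: "('s, 'a, 'b) csg \<Rightarrow> 's \<Rightarrow> 'b pmf set" where
  "local_strategies2 G s = {\<sigma>. set_pmf \<sigma> \<subseteq> enabled2 G s}"

text \<open>
  Memoryless strategies are unconstrained outside \<open>states G\<close>; this is harmless, since
  chains started in \<open>states G\<close> never leave it.
\<close>

definition strategies1 :: "('s, 'a, 'b) csg \<Rightarrow> ('s \<Rightarrow> 'a pmf) set" where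
  "strategies1 G = {\<rho>. \<forall>s\<in>states G. \<rho> s \<in> local_strategies1 G s}"

definition strategies2 :: "('s, 'a, 'b) csg \<Rightarrow> ('s \<Rightarrow> 'b pmf) set" where
  "strategies2 G = {\<sigma>. \<forall>s\<in>states G. \<sigma> s \<in> local_strategies2 G s}"

definition induced_chain ::
    "('s, 'a, 'b) csg \<Rightarrow> ('s \<Rightarrow> 'a pmf) \<Rightarrow> ('s \<Rightarrow> 'b pmf) \<Rightarrow> 's \<Rightarrow> 's pmf" where
  "induced_chain G \<rho> \<sigma> s =
     bind_pmf (\<rho> s) (\<lambda>a. bind_pmf (\<sigma> s) (\<lambda>b. transition G s a b))"

definition reach_prob ::
    "('s, 'a, 'b) csg \<Rightarrow> ('s \<Rightarrow> 'a pmf) \<Rightarrow> ('s \<Rightarrow> 'b pmf) \<Rightarrow> 's \<Rightarrow> real" where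
  "reach_prob G \<rho> \<sigma> s =
     measure (mc_paths (induced_chain G \<rho> \<sigma>) s) {\<omega>. \<exists>n. \<omega> n \<in> target G}"

definition game_value :: "('s, 'a, 'b) csg \<Rightarrow> 's \<Rightarrow> real" where
  "game_value G s = (SUP \<rho>\<in>strategies1 G. INF \<sigma>\<in>strategies2 G. reach_prob G \<rho> \<sigma> s)"

definition zero_states :: "('s, 'a, 'b) csg \<Rightarrow> 's set" where
  "zero_states G = {s \<in> states G. game_value G s = 0}"

definition absorbing :: "('s, 'a, 'b) csg \<Rightarrow> 's \<Rightarrow> bool" where
  "absorbing G s \<longleftrightarrow>
     (\<forall>a\<in>enabled1 G s. \<forall>b\<in>enabled2 G s. transition G s a b = return_pmf s)"

definition post :: "('s, 'a, 'b) csg \<Rightarrow> 's \<Rightarrow> 'a pmf \<Rightarrow> 'b pmf \<Rightarrow> 's set" where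
  "post G s \<rho> \<sigma> = (\<Union>a\<in>set_pmf \<rho>. \<Union>b\<in>set_pmf \<sigma>. set_pmf (transition G s a b))"

definition end_component :: "('s, 'a, 'b) csg \<Rightarrow> 's set \<Rightarrow> bool" where
  "end_component G X \<longleftrightarrow>
     X \<noteq> {} \<and> X \<subseteq> states G \<and>
     (\<exists>\<rho> \<sigma>.
        (\<forall>s\<in>X. \<rho> s \<in> local_strategies1 G s \<and> \<sigma> s \<in> local_strategies2 G s \<and>
           post G s (\<rho> s) (\<sigma> s) \<subseteq> X) \<and>
        (\<forall>s\<in>X. \<forall>t\<in>X. (s, t) \<in> {(u, v). u \<in> X \<and> v \<in> post G u (\<rho> u) (\<sigma> u)}\<^sup>*))"

definition bellman :: "('s, 'a, 'b) csg \<Rightarrow> ('s \<Rightarrow> real) \<Rightarrow> 's \<Rightarrow> real" where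
  "bellman G v s =
     (SUP \<rho>\<in>local_strategies1 G s. INF \<sigma>\<in>local_strategies2 G s.
        \<Sum>a\<in>enabled1 G s. \<Sum>b\<in>enabled2 G s. \<Sum>s'\<in>states G.
          pmf \<rho> a * pmf \<sigma> b * pmf (transition G s a b) s' * v s')"

primrec over_approx :: "('s, 'a, 'b) csg \<Rightarrow> nat \<Rightarrow> 's \<Rightarrow> real" where
  "over_approx G 0 = (\<lambda>s. if s \<in> zero_states G then 0 else 1)"
| "over_approx G (Suc k) = bellman G (over_approx G k)"

end

theory Submission
  imports Defs
begin

text \<open>
  If every end component lies in \<open>{t, w}\<close> (target and zero state), then the states carry a rank,
  zero exactly on \<open>{t, w}\<close>, such that every pair of actions in a state outside \<open>{t, w}\<close> has a
  successor of smaller rank: otherwise some pairs of actions trap the play in a set avoiding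
  \<open>{t, w}\<close>, and a bottom strongly connected component of that set is an end component.  With \<open>p\<close>
  the least positive transition probability, the potential \<open>h s = 1 - (p/2) ^ rank s\<close> shrinks in
  expectation by a factor \<open>\<beta> < 1\<close> per step, whatever both players do.  Hence consecutive
  over-approximations differ by at most \<open>2 * \<beta> ^ k * h\<close>.

  Let \<open>U\<close> be the \<open>k\<close>-th over-approximation and \<open>c = 2 * \<beta> ^ k + e\<close>.  When Player 1 plays almost
  optimally for the one-step games with payoff \<open>U\<close>, the function \<open>U - c / (1 - \<beta>) * h\<close> is a
  submartingale along every induced chain, so it is a lower bound for the reachability probability;
  when Player 2 answers almost optimally, \<open>U + c / (1 - \<beta>) * h\<close> is a supermartingale and an upper
  bound.  Therefore \<open>U\<close> is within \<open>c / (1 - \<beta>) * h\<close> of the value.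
\<close>

section \<open>One-dimensional marginals of a Markov chain\<close>

text \<open>Restricting to an initial segment of coordinates forgets nothing of the composed
  kernels. This links the marginals of the path measure, indexed by sets, with \<open>mc.C\<close>,
  which obeys a recursion over the kernels.\<close>

lemma mc_CI_eq_C: "mc.CI K s {0..<n} = mc.C K s 0 n (\<lambda>_. undefined)"
proof -
  let ?M = "\<lambda>_::nat. count_space (UNIV :: 'a set)"
  have u: "(\<lambda>_. undefined) \<in> space (PiM {0..<0::nat} ?M)"
    by (simp add: space_PiM)
  note sC = mc.sets_C[OF u, of K s n, simplified]
  show ?thesis
  proof (rule measure_eqI)
    show "sets (mc.CI K s {0..<n}) = sets (mc.C K s 0 n (\<lambda>_. undefined))"
      by (simp add: mc.CI_def sC)
    fix A assume "A \<in> sets (mc.CI K s {0..<n})"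
    then have A: "A \<in> sets (PiM {0..<n} ?M)"
      by (simp add: mc.CI_def)
    then show "emeasure (mc.CI K s {0..<n}) A = emeasure (mc.C K s 0 n (\<lambda>_. undefined)) A"
      using mc.emeasure_CI[of "{0..<n}" n A K s] sets.sets_into_space[OF A]
      by (simp add: prod_emb_id space_PiM)
  qed
qed

lemma nn_integral_mc_paths_prefix:
  fixes K :: "'s \<Rightarrow> 's pmf" and g :: "(nat \<Rightarrow> 's) \<Rightarrow> ennreal"
  assumes "g \<in> borel_measurable (PiM {0..<n} (\<lambda>_. count_space UNIV))"
  shows "(\<integral>\<^sup>+\<omega>. g (restrict \<omega> {0..<n}) \<partial>mc_paths K s) =
    (\<integral>\<^sup>+\<omega>. g \<omega> \<partial>mc.C K s 0 n (\<lambda>_. undefined))"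
proof -
  let ?M = "\<lambda>_::nat. count_space (UNIV :: 's set)"
  have "(\<lambda>\<omega>. restrict \<omega> {0..<n}) \<in> measurable (mc_paths K s) (PiM {0..<n} ?M)"
    by (subst measurable_cong_sets[OF sets_mc_paths refl]) (rule measurable_restrict_subset, simp)
  then have "(\<integral>\<^sup>+\<omega>. g (restrict \<omega> {0..<n}) \<partial>mc_paths K s) =
      (\<integral>\<^sup>+\<omega>. g \<omega> \<partial>distr (mc_paths K s) (PiM {0..<n} ?M) (\<lambda>\<omega>. restrict \<omega> {0..<n}))"
    using assms by (simp add: nn_integral_distr)
  then show ?thesis
    unfolding mc_paths_def by (simp add: mc.distr_lim mc_CI_eq_C)
qed

text \<open>The Markov property for two consecutive coordinates: the last kernel of the prefix
  depends only on coordinate \<open>n\<close>, and \<open>f (\<omega> n)\<close> is constant while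
  that kernel is integrated out.\<close>

lemma nn_integral_mc_paths_Suc:
  fixes K :: "'s \<Rightarrow> 's pmf" and f g :: "'s \<Rightarrow> ennreal"
  shows "(\<integral>\<^sup>+\<omega>. f (\<omega> n) * g (\<omega> (Suc n)) \<partial>mc_paths K s) =
    (\<integral>\<^sup>+\<omega>. f (\<omega> n) * (\<integral>\<^sup>+y. g y \<partial>K (\<omega> n)) \<partial>mc_paths K s)"
proof -
  let ?M = "\<lambda>k. PiM {0..<k} (\<lambda>_::nat. count_space (UNIV :: 's set))"
  let ?C = "\<lambda>k. mc.C K s 0 k (\<lambda>_. undefined)"
  have u: "(\<lambda>_. undefined) \<in> space (?M 0)"
    by (simp add: space_PiM)
  note sC = mc.sets_C[OF u, of K s, simplified]
  note spC = mc.space_C[OF u, of K s, simplified]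
  have comp: "(\<lambda>\<omega>. h (\<omega> i)) \<in> borel_measurable (?M k)" if "i < k"
    for h :: "'s \<Rightarrow> ennreal" and i k
    using that by (intro measurable_compose[OF measurable_component_singleton]) auto
  \<comment> \<open>Coordinates start at 0, so a prefix that contains coordinate
    \<open>Suc n\<close> has length \<open>Suc (Suc n)\<close>.\<close>
  have "(\<integral>\<^sup>+\<omega>. f (\<omega> n) * g (\<omega> (Suc n)) \<partial>mc_paths K s) =
      (\<integral>\<^sup>+\<omega>. f (\<omega> n) * g (\<omega> (Suc n)) \<partial>?C (Suc (Suc n)))"
    using nn_integral_mc_paths_prefix[of "\<lambda>\<omega>. f (\<omega> n) * g (\<omega> (Suc n))" "Suc (Suc n)" K s]
      comp[of n "Suc (Suc n)" f] comp[of "Suc n" "Suc (Suc n)" g] by simp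
  also have "\<dots> = (\<integral>\<^sup>+\<omega>. (\<integral>\<^sup>+\<omega>'. f (\<omega>' n) * g (\<omega>' (Suc n)) \<partial>mc.eP K s (Suc n) \<omega>) \<partial>?C (Suc n))"
    using mc.measurable_eP[of K s "Suc n"] comp[of n "Suc (Suc n)" f] comp[of "Suc n" "Suc (Suc n)" g]
    by (subst mc.C.simps(2), subst nn_integral_bind[where B="?M (Suc (Suc n))"])
       (auto simp: measurable_cong_sets[OF sC refl] simp del: mc.C.simps)
  also have "\<dots> = (\<integral>\<^sup>+\<omega>. f (\<omega> n) * (\<integral>\<^sup>+y. g y \<partial>K (\<omega> n)) \<partial>?C (Suc n))"
  proof (rule nn_integral_cong)
    fix \<omega> assume "\<omega> \<in> space (?C (Suc n))"
    then have "\<omega> \<in> space (?M (Suc n))" by (simp only: spC)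
    then show "(\<integral>\<^sup>+\<omega>'. f (\<omega>' n) * g (\<omega>' (Suc n)) \<partial>mc.eP K s (Suc n) \<omega>) =
        f (\<omega> n) * (\<integral>\<^sup>+y. g y \<partial>K (\<omega> n))"
      using comp[of n "Suc (Suc n)" f] comp[of "Suc n" "Suc (Suc n)" g]
      by (subst mc.nn_integral_eP) (simp_all add: mc_kernel_def nn_integral_cmult)
  qed
  also have "\<dots> = (\<integral>\<^sup>+\<omega>. f (\<omega> n) * (\<integral>\<^sup>+y. g y \<partial>K (\<omega> n)) \<partial>mc_paths K s)"
    using nn_integral_mc_paths_prefix[of "\<lambda>\<omega>. f (\<omega> n) * (\<integral>\<^sup>+y. g y \<partial>K (\<omega> n))" "Suc n" K s]
      comp[of n "Suc n" f] comp[of n "Suc n" "\<lambda>x. \<integral>\<^sup>+y. g y \<partial>K x"] by simp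
  finally show ?thesis .
qed

lemma sets_mc_paths_coordinate: "{\<omega>. P (\<omega> n)} \<in> sets (mc_paths K s)"
  using measurable_sets[OF mc_paths_component[of n K s], of "Collect P"]
  by (simp add: space_mc_paths vimage_def)

text \<open>The event of leaving \<open>T\<close> has measure zero: in the Markov property, the
  indicator of the complement of \<open>T\<close> integrates to 0 against a point mass inside
  \<open>T\<close>. Single paths that leave \<open>T\<close> still belong to the path space, hence
  the almost sure form.\<close>

lemma AE_mc_paths_absorbing:
  assumes "\<And>t. t \<in> T \<Longrightarrow> K t = return_pmf t"
  shows "AE \<omega> in mc_paths K s. \<omega> n \<in> T \<longrightarrow> \<omega> (Suc n) \<in> T"
proof -
  have "emeasure (mc_paths K s) {\<omega>. \<omega> n \<in> T \<and> \<omega> (Suc n) \<notin> T} =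
      (\<integral>\<^sup>+\<omega>. indicator T (\<omega> n) * indicator (- T) (\<omega> (Suc n)) \<partial>mc_paths K s)"
    using sets.Int[OF sets_mc_paths_coordinate[of "\<lambda>x. x \<in> T" n K s]
      sets_mc_paths_coordinate[of "\<lambda>x. x \<notin> T" "Suc n" K s]]
    by (subst nn_integral_indicator[symmetric])
       (auto intro!: nn_integral_cong split: split_indicator simp: Int_def simp del: nn_integral_indicator)
  also have "\<dots> = (\<integral>\<^sup>+\<omega>. 0 \<partial>mc_paths K s)"
    unfolding nn_integral_mc_paths_Suc
    using assms by (intro nn_integral_cong) (auto split: split_indicator)
  finally show ?thesis
    using sets.Int[OF sets_mc_paths_coordinate[of "\<lambda>x. x \<in> T" n K s]
      sets_mc_paths_coordinate[of "\<lambda>x. x \<notin> T" "Suc n" K s]]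
    by (intro AE_I[of _ _ "{\<omega>. \<omega> n \<in> T \<and> \<omega> (Suc n) \<notin> T}"]) (auto simp: Int_def)
qed

section \<open>Laws of single coordinates and reachability as their limit\<close>

primrec nstep :: "('s \<Rightarrow> 's pmf) \<Rightarrow> 's \<Rightarrow> nat \<Rightarrow> 's pmf" where
  "nstep K s 0 = return_pmf s"
| "nstep K s (Suc n) = bind_pmf (nstep K s n) K"

text \<open>The induction is over the whole law of coordinate \<open>n\<close>, because the step
  integrates \<open>K\<close> against that law. Afterwards expectations over finite supports can
  replace integrals over paths.\<close>

lemma emeasure_mc_paths_coordinate:
  "emeasure (mc_paths K s) {\<omega>. \<omega> n \<in> A} = emeasure (measure_pmf (nstep K s n)) A"
proof -
  have ind: "emeasure (mc_paths K s) {\<omega>. \<omega> n \<in> A} = (\<integral>\<^sup>+\<omega>. indicator A (\<omega> n) \<partial>mc_paths K s)" for n A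
    using sets_mc_paths_coordinate[of "\<lambda>x. x \<in> A" n K s]
    by (subst nn_integral_indicator[symmetric])
       (auto intro!: nn_integral_cong split: split_indicator simp del: nn_integral_indicator)
  have "distr (mc_paths K s) (count_space UNIV) (\<lambda>\<omega>. \<omega> n) = measure_pmf (nstep K s n)"
  proof (induction n)
    case 0
    have "(\<integral>\<^sup>+\<omega>. h (\<omega> 0) \<partial>mc_paths K s) = h s" for h :: "'a \<Rightarrow> ennreal"
    proof -
      let ?M = "\<lambda>k. PiM {0..<k} (\<lambda>_::nat. count_space (UNIV :: 'a set))"
      have u: "(\<lambda>_. undefined) \<in> space (?M 0)"
        by (simp add: space_PiM)
      have h: "(\<lambda>\<omega>. h (\<omega> 0)) \<in> borel_measurable (?M (Suc 0))"
        by (intro measurable_compose[OF measurable_component_singleton]) auto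
      have "(\<integral>\<^sup>+\<omega>. h (\<omega> 0) \<partial>mc_paths K s) = (\<integral>\<^sup>+\<omega>. h (\<omega> 0) \<partial>mc.C K s 0 (Suc 0) (\<lambda>_. undefined))"
        using nn_integral_mc_paths_prefix[of "\<lambda>\<omega>. h (\<omega> 0)" "Suc 0" K s] h by simp
      \<comment> \<open>The composition starts from a point mass on the empty history, here
        represented by the constant \<open>undefined\<close> function.\<close>
      also have "\<dots> = (\<integral>\<^sup>+\<omega>. h (\<omega> 0) \<partial>mc.eP K s 0 (\<lambda>_. undefined))"
        using bind_return[OF mc.measurable_eP[of K s 0] u] by simp
      also have "\<dots> = h s"
        using mc.nn_integral_eP[OF u h, of K s] by (simp add: mc_kernel_def)
      finally show ?thesis .
    qed
    from this[of "indicator A" for A] show ?case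
      by (intro measure_eqI) (simp_all add: emeasure_distr[OF mc_paths_component] space_mc_paths vimage_def ind)
  next
    case (Suc n)
    show ?case
    proof (rule measure_eqI)
      fix A
      have "emeasure (distr (mc_paths K s) (count_space UNIV) (\<lambda>\<omega>. \<omega> (Suc n))) A =
          (\<integral>\<^sup>+\<omega>. indicator A (\<omega> (Suc n)) \<partial>mc_paths K s)"
        by (simp add: emeasure_distr[OF mc_paths_component] space_mc_paths vimage_def ind)
      also have "\<dots> = (\<integral>\<^sup>+\<omega>. emeasure (K (\<omega> n)) A \<partial>mc_paths K s)"
        using nn_integral_mc_paths_Suc[where f="\<lambda>_. 1" and g="indicator A" and K=K and s=s and n=n] by simp
      also have "\<dots> = (\<integral>\<^sup>+x. emeasure (K x) A \<partial>distr (mc_paths K s) (count_space UNIV) (\<lambda>\<omega>. \<omega> n))"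
        by (subst nn_integral_distr[OF mc_paths_component]) simp_all
      also have "\<dots> = emeasure (nstep K s (Suc n)) A"
        unfolding Suc.IH by simp
      finally show "emeasure (distr (mc_paths K s) (count_space UNIV) (\<lambda>\<omega>. \<omega> (Suc n))) A =
        emeasure (nstep K s (Suc n)) A" .
    qed simp
  qed
  then show ?thesis
    using emeasure_distr[OF mc_paths_component[of n K s], of A] by (simp add: space_mc_paths vimage_def)
qed

text \<open>For absorbing \<open>T\<close>, being in \<open>T\<close> at time \<open>n\<close>
  almost surely coincides with having visited \<open>T\<close> by time \<open>n\<close>. The latter
  events increase to the reachability event, so continuity from below gives the limit.\<close>

lemma nstep_absorbing_tendsto_reach:
  assumes "\<And>t. t \<in> T \<Longrightarrow> K t = return_pmf t"
  shows "(\<lambda>n. measure_pmf.prob (nstep K s n) T) \<longlonglongrightarrow> measure (mc_paths K s) {\<omega>. \<exists>n. \<omega> n \<in> T}"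
proof -
  interpret prob_space "mc_paths K s"
    by (rule prob_space_mc_paths)
  let ?B = "\<lambda>n::nat. {\<omega>. \<exists>i\<le>n. \<omega> i \<in> T}"
  have sB: "?B n \<in> events" for n
  proof -
    have "?B n = (\<Union>i\<le>n. {\<omega>. \<omega> i \<in> T})" by auto
    then show ?thesis
      using sets_mc_paths_coordinate[of "\<lambda>x. x \<in> T"] by auto
  qed
  have "prob (?B n) = measure_pmf.prob (nstep K s n) T" for n
  proof -
    have "AE \<omega> in mc_paths K s. \<forall>n. \<omega> n \<in> T \<longrightarrow> \<omega> (Suc n) \<in> T"
      using AE_mc_paths_absorbing[of T K] assms by (simp add: AE_all_countable)
    then have "AE \<omega> in mc_paths K s. \<omega> \<in> ?B n \<longleftrightarrow> \<omega> \<in> {\<omega>. \<omega> n \<in> T}"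
    proof eventually_elim
      case (elim \<omega>)
      have "\<omega> n \<in> T" if "i \<le> n" "\<omega> i \<in> T" for i
        using that by (induction rule: dec_induct) (use elim in auto)
      then show ?case by auto
    qed
    then have "prob (?B n) = prob {\<omega>. \<omega> n \<in> T}"
      using sB sets_mc_paths_coordinate[of "\<lambda>x. x \<in> T" n K s] by (intro finite_measure_eq_AE) auto
    then show ?thesis
      by (simp add: measure_def emeasure_mc_paths_coordinate)
  qed
  moreover have "(\<lambda>n. prob (?B n)) \<longlonglongrightarrow> prob (\<Union>n. ?B n)"
    using sB by (intro finite_Lim_measure_incseq) (auto simp: incseq_def intro: order_trans)
  moreover have "(\<Union>n. ?B n) = {\<omega>. \<exists>n. \<omega> n \<in> T}"
    by auto
  ultimately show ?thesis by simp
qed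

section \<open>Bounded sup-inf values\<close>

text \<open>Suprema and infima of reals are meaningful only for bounded families; payoffs in
  \<open>{0..1}\<close> provide the bounds. This lemma and \<open>SUP_INF_le\<close> serve both the
  Bellman operator and the game value.\<close>

lemma le_SUP_INF:
  fixes F :: "'x \<Rightarrow> 'y \<Rightarrow> real"
  assumes "\<And>x y. x \<in> A \<Longrightarrow> y \<in> B \<Longrightarrow> F x y \<in> {0..1}" "B \<noteq> {}"
    and "x \<in> A" "\<And>y. y \<in> B \<Longrightarrow> c \<le> F x y"
  shows "c \<le> (SUP x\<in>A. INF y\<in>B. F x y)"
proof -
  have "c \<le> (INF y\<in>B. F x y)"
    using assms by (intro cINF_greatest) auto
  also have "\<dots> \<le> (SUP x\<in>A. INF y\<in>B. F x y)"
  proof (rule cSUP_upper[OF assms(3)], rule bdd_aboveI2)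
    fix x assume x: "x \<in> A"
    obtain y where y: "y \<in> B" using assms(2) by auto
    have "(INF y\<in>B. F x y) \<le> F x y"
      using x y assms(1) by (intro cINF_lower bdd_belowI2[where m=0]) auto
    also have "\<dots> \<le> 1"
      using x y assms(1) by auto
    finally show "(INF y\<in>B. F x y) \<le> 1" .
  qed
  finally show ?thesis .
qed

lemma SUP_INF_le:
  fixes F :: "'x \<Rightarrow> 'y \<Rightarrow> real"
  assumes "\<And>x y. x \<in> A \<Longrightarrow> y \<in> B \<Longrightarrow> F x y \<in> {0..1}" "A \<noteq> {}"
    and "\<And>x. x \<in> A \<Longrightarrow> \<exists>y\<in>B. F x y \<le> c"
  shows "(SUP x\<in>A. INF y\<in>B. F x y) \<le> c"
proof (rule cSUP_least[OF assms(2)])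
  fix x assume x: "x \<in> A"
  then obtain y where y: "y \<in> B" "F x y \<le> c" using assms(3) by auto
  have "(INF y\<in>B. F x y) \<le> F x y"
    using x y assms(1) by (intro cINF_lower bdd_belowI2[where m=0]) auto
  with y show "(INF y\<in>B. F x y) \<le> c" by simp
qed

text \<open>If no \<open>x\<close> were \<open>e\<close>-optimal, each would have a reply at most
  the value minus \<open>e\<close>, which would push the value below itself.\<close>

lemma SUP_INF_maximizer:
  fixes F :: "'x \<Rightarrow> 'y \<Rightarrow> real"
  assumes "\<And>x y. x \<in> A \<Longrightarrow> y \<in> B \<Longrightarrow> F x y \<in> {0..1}" "A \<noteq> {}" "B \<noteq> {}" "e > 0"
  shows "\<exists>x\<in>A. \<forall>y\<in>B. (SUP x\<in>A. INF y\<in>B. F x y) - e \<le> F x y"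
proof (rule ccontr)
  assume "\<not> ?thesis"
  then have "\<exists>y\<in>B. F x y \<le> (SUP x\<in>A. INF y\<in>B. F x y) - e" if "x \<in> A" for x
    using that by (meson linear)
  then have "(SUP x\<in>A. INF y\<in>B. F x y) \<le> (SUP x\<in>A. INF y\<in>B. F x y) - e"
    using assms by (intro SUP_INF_le) auto
  with \<open>e > 0\<close> show False by simp
qed

text \<open>If all replies to \<open>x\<close> gave at least the value plus \<open>e\<close>, then
  \<open>x\<close> alone would lift the supremum above itself.\<close>

lemma SUP_INF_response:
  fixes F :: "'x \<Rightarrow> 'y \<Rightarrow> real"
  assumes "\<And>x y. x \<in> A \<Longrightarrow> y \<in> B \<Longrightarrow> F x y \<in> {0..1}" "B \<noteq> {}" "x \<in> A" "e > 0"
  shows "\<exists>y\<in>B. F x y \<le> (SUP x\<in>A. INF y\<in>B. F x y) + e"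
proof (rule ccontr)
  assume "\<not> ?thesis"
  then have "\<And>y. y \<in> B \<Longrightarrow> (SUP x\<in>A. INF y\<in>B. F x y) + e \<le> F x y"
    by (meson linear)
  then have "(SUP x\<in>A. INF y\<in>B. F x y) + e \<le> (SUP x\<in>A. INF y\<in>B. F x y)"
    using assms by (intro le_SUP_INF[where x=x]) auto
  with \<open>e > 0\<close> show False by simp
qed

section \<open>One-step values in a concurrent game\<close>

text \<open>The double bind of \<open>induced_chain\<close>, taken for local strategies at one
  state, so that drift estimates can range over all local pairs.\<close>

definition local_step :: "('s, 'a, 'b) csg \<Rightarrow> 's \<Rightarrow> 'a pmf \<Rightarrow> 'b pmf \<Rightarrow> 's pmf" where
  "local_step G s \<rho> \<sigma> = bind_pmf \<rho> (\<lambda>a. bind_pmf \<sigma> (\<lambda>b. transition G s a b))"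

lemma induced_chain_eq_local_step: "induced_chain G \<rho> \<sigma> s = local_step G s (\<rho> s) (\<sigma> s)"
  by (simp add: induced_chain_def local_step_def)

lemma local_step_absorbing:
  assumes "absorbing G s" "\<rho> \<in> local_strategies1 G s" "\<sigma> \<in> local_strategies2 G s"
  shows "local_step G s \<rho> \<sigma> = return_pmf s"
proof -
  have "local_step G s \<rho> \<sigma> = bind_pmf \<rho> (\<lambda>a. bind_pmf \<sigma> (\<lambda>b. return_pmf s))"
    using assms unfolding local_step_def
    by (intro bind_pmf_cong refl)
       (auto simp: absorbing_def local_strategies1_def local_strategies2_def subset_iff)
  then show ?thesis by simp
qed

locale csg_game =
  fixes G :: "('s, 'a, 'b) csg"
  assumes wf: "wf_csg G"
begin

abbreviation step_value :: "('s \<Rightarrow> real) \<Rightarrow> 's \<Rightarrow> 'a pmf \<Rightarrow> 'b pmf \<Rightarrow> real" where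
  "step_value v s \<rho> \<sigma> \<equiv> measure_pmf.expectation (local_step G s \<rho> \<sigma>) v"

lemma finite_states: "finite (states G)"
  and enabled1_nonempty: "s \<in> states G \<Longrightarrow> enabled1 G s \<noteq> {}"
  and enabled2_nonempty: "s \<in> states G \<Longrightarrow> enabled2 G s \<noteq> {}"
  using wf by (auto simp: wf_csg_def)

lemma finite_enabled1: "s \<in> states G \<Longrightarrow> finite (enabled1 G s)"
  using wf unfolding wf_csg_def by (meson finite_subset)

lemma finite_enabled2: "s \<in> states G \<Longrightarrow> finite (enabled2 G s)"
  using wf unfolding wf_csg_def by (meson finite_subset)

lemma set_transition:
  "s \<in> states G \<Longrightarrow> a \<in> enabled1 G s \<Longrightarrow> b \<in> enabled2 G s \<Longrightarrow>
    set_pmf (transition G s a b) \<subseteq> states G"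
  using wf unfolding wf_csg_def by (meson subsetD)

lemma finite_transition:
  assumes "s \<in> states G" "a \<in> enabled1 G s" "b \<in> enabled2 G s"
  shows "finite (set_pmf (transition G s a b))"
  using set_transition[OF assms] finite_states by (rule finite_subset)

lemma local_strategies1_nonempty:
  assumes "s \<in> states G"
  shows "local_strategies1 G s \<noteq> {}"
proof -
  obtain a where "a \<in> enabled1 G s"
    using enabled1_nonempty[OF assms] by auto
  then have "return_pmf a \<in> local_strategies1 G s"
    by (simp add: local_strategies1_def)
  then show ?thesis by auto
qed

lemma local_strategies2_nonempty:
  assumes "s \<in> states G"
  shows "local_strategies2 G s \<noteq> {}"
proof -
  obtain a where "a \<in> enabled2 G s"
    using enabled2_nonempty[OF assms] by auto
  then have "return_pmf a \<in> local_strategies2 G s"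
    by (simp add: local_strategies2_def)
  then show ?thesis by auto
qed

lemma strategies1_nonempty: "strategies1 G \<noteq> {}"
proof -
  have "\<forall>s\<in>states G. \<exists>\<rho>. \<rho> \<in> local_strategies1 G s"
    using local_strategies1_nonempty by blast
  then show ?thesis
    unfolding strategies1_def by (auto dest: bchoice)
qed

lemma strategies2_nonempty: "strategies2 G \<noteq> {}"
proof -
  have "\<forall>s\<in>states G. \<exists>\<rho>. \<rho> \<in> local_strategies2 G s"
    using local_strategies2_nonempty by blast
  then show ?thesis
    unfolding strategies2_def by (auto dest: bchoice)
qed

section \<open>Expected payoff of one step under local strategies\<close>

context
  fixes s \<rho> \<sigma>
  assumes s: "s \<in> states G" and \<rho>: "\<rho> \<in> local_strategies1 G s" and \<sigma>: "\<sigma> \<in> local_strategies2 G s"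
begin

lemma set_local_step: "set_pmf (local_step G s \<rho> \<sigma>) \<subseteq> states G"
  using s \<rho> \<sigma> set_transition
  by (fastforce simp: local_step_def local_strategies1_def local_strategies2_def)

lemma integrable_local_step: "integrable (local_step G s \<rho> \<sigma>) (v :: 's \<Rightarrow> real)"
  using finite_subset[OF set_local_step finite_states] by (rule integrable_measure_pmf_finite)

lemma step_value_eq_sum_actions:
  "step_value v s \<rho> \<sigma> = (\<Sum>a\<in>enabled1 G s. \<Sum>b\<in>enabled2 G s.
     pmf \<rho> a * pmf \<sigma> b * measure_pmf.expectation (transition G s a b) v)"
proof -
  have "finite (set_pmf (bind_pmf \<sigma> (\<lambda>b. transition G s a b)))" if "a \<in> enabled1 G s" for a
    unfolding set_bind_pmf using \<sigma> finite_transition[OF s that]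
    by (intro finite_UN_I finite_subset[OF _ finite_enabled2[OF s]])
       (auto simp: local_strategies2_def)
  then have "step_value v s \<rho> \<sigma> = (\<Sum>a\<in>enabled1 G s. pmf \<rho> a *\<^sub>R
      measure_pmf.expectation (bind_pmf \<sigma> (\<lambda>b. transition G s a b)) v)"
    unfolding local_step_def using s \<rho> finite_enabled1
    by (intro pmf_expectation_bind) (auto simp: local_strategies1_def)
  also have "\<dots> = (\<Sum>a\<in>enabled1 G s. pmf \<rho> a *\<^sub>R (\<Sum>b\<in>enabled2 G s. pmf \<sigma> b *\<^sub>R
      measure_pmf.expectation (transition G s a b) v))"
    using s \<sigma> finite_transition finite_enabled2
    by (intro sum.cong refl arg_cong2[where f=scaleR] pmf_expectation_bind)
       (auto simp: local_strategies2_def)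
  finally show ?thesis
    by (simp add: sum_distrib_left mult.assoc)
qed

text \<open>Recognizes the triple sum in \<open>bellman\<close> as an expectation, which makes
  linearity and monotonicity of the integral available.\<close>

lemma step_value_eq_sum:
  "step_value v s \<rho> \<sigma> = (\<Sum>a\<in>enabled1 G s. \<Sum>b\<in>enabled2 G s. \<Sum>s'\<in>states G.
     pmf \<rho> a * pmf \<sigma> b * pmf (transition G s a b) s' * v s')"
proof -
  have "measure_pmf.expectation (transition G s a b) v =
      (\<Sum>s'\<in>states G. pmf (transition G s a b) s' * v s')"
    if "a \<in> enabled1 G s" "b \<in> enabled2 G s" for a b
    using set_transition[OF s that] by (subst integral_measure_pmf[OF finite_states]) auto
  then show ?thesis
    unfolding step_value_eq_sum_actions
    by (intro sum.cong refl) (simp add: sum_distrib_left mult.assoc)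
qed

text \<open>A mixed choice averages over pairs of actions with weights of total mass 1. This lifts
  the drift of the potential from pure pairs to mixed strategies.\<close>

lemma step_value_le_of_actions:
  assumes "\<And>a b. a \<in> enabled1 G s \<Longrightarrow> b \<in> enabled2 G s \<Longrightarrow>
    measure_pmf.expectation (transition G s a b) v \<le> c"
  shows "step_value v s \<rho> \<sigma> \<le> c"
proof -
  have 1: "(\<Sum>a\<in>enabled1 G s. pmf \<rho> a) = 1" "(\<Sum>b\<in>enabled2 G s. pmf \<sigma> b) = 1"
    using s \<rho> \<sigma> finite_enabled1 finite_enabled2
    by (auto simp: local_strategies1_def local_strategies2_def intro!: sum_pmf_eq_1)
  have "step_value v s \<rho> \<sigma> \<le> (\<Sum>a\<in>enabled1 G s. \<Sum>b\<in>enabled2 G s. pmf \<rho> a * pmf \<sigma> b * c)"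
    unfolding step_value_eq_sum_actions
    by (intro sum_mono mult_left_mono assms) auto
  also have "\<dots> = (\<Sum>a\<in>enabled1 G s. pmf \<rho> a) * (\<Sum>b\<in>enabled2 G s. pmf \<sigma> b) * c"
    by (subst sum_product) (simp only: sum_distrib_right)
  finally show ?thesis by (simp add: 1)
qed

lemma step_value_mono:
  assumes "\<And>x. x \<in> states G \<Longrightarrow> u x \<le> v x"
  shows "step_value u s \<rho> \<sigma> \<le> step_value v s \<rho> \<sigma>"
  using set_local_step assms
  by (intro integral_mono_AE integrable_local_step) (auto simp: AE_measure_pmf_iff)

lemma step_value_range:
  assumes "v \<in> states G \<rightarrow> {0..1}"
  shows "step_value v s \<rho> \<sigma> \<in> {0..1}"
  using step_value_mono[of "\<lambda>_. 0" v] step_value_mono[of v "\<lambda>_. 1"] assms by (simp add: Pi_iff)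

lemma step_value_add_mult:
  "step_value (\<lambda>x. u x + c * v x) s \<rho> \<sigma> = step_value u s \<rho> \<sigma> + c * step_value v s \<rho> \<sigma>"
  using integrable_local_step by simp

end

lemma bellman_eq_step_value:
  assumes "s \<in> states G"
  shows "bellman G v s =
    (SUP \<rho>\<in>local_strategies1 G s. INF \<sigma>\<in>local_strategies2 G s. step_value v s \<rho> \<sigma>)"
  unfolding bellman_def
  by (intro SUP_cong INF_cong refl) (simp add: step_value_eq_sum assms)

section \<open>The Bellman operator on valuations in the unit interval\<close>

context
  fixes v :: "'s \<Rightarrow> real" and s :: 's
  assumes v: "v \<in> states G \<rightarrow> {0..1}" and s: "s \<in> states G"
begin

lemmas step_value_bounded = step_value_range[OF s _ _ v]

lemma bellman_maximizer:
  assumes "e > 0"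
  shows "\<exists>\<rho>\<in>local_strategies1 G s. \<forall>\<sigma>\<in>local_strategies2 G s. bellman G v s - e \<le> step_value v s \<rho> \<sigma>"
  unfolding bellman_eq_step_value[OF s]
  using step_value_bounded local_strategies1_nonempty[OF s] local_strategies2_nonempty[OF s] assms
  by (rule SUP_INF_maximizer)

lemma bellman_response:
  assumes "e > 0" "\<rho> \<in> local_strategies1 G s"
  shows "\<exists>\<sigma>\<in>local_strategies2 G s. step_value v s \<rho> \<sigma> \<le> bellman G v s + e"
  unfolding bellman_eq_step_value[OF s]
  using step_value_bounded local_strategies2_nonempty[OF s] assms(2,1)
  by (rule SUP_INF_response)

lemma bellman_range: "bellman G v s \<in> {0..1}"
proof -
  obtain \<rho> where "\<rho> \<in> local_strategies1 G s"
    using local_strategies1_nonempty[OF s] by auto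
  then have "0 \<le> bellman G v s"
    unfolding bellman_eq_step_value[OF s]
    using step_value_bounded local_strategies2_nonempty[OF s] by (intro le_SUP_INF) auto
  moreover have "bellman G v s \<le> 1"
    unfolding bellman_eq_step_value[OF s]
  proof (rule SUP_INF_le)
    fix \<rho> assume "\<rho> \<in> local_strategies1 G s"
    then show "\<exists>\<sigma>\<in>local_strategies2 G s. step_value v s \<rho> \<sigma> \<le> 1"
      using step_value_bounded local_strategies2_nonempty[OF s] by fastforce
  qed (use step_value_bounded local_strategies1_nonempty[OF s] in auto)
  ultimately show ?thesis by simp
qed

lemma bellman_absorbing:
  assumes "absorbing G s"
  shows "bellman G v s = v s"
  unfolding bellman_eq_step_value[OF s]
  using local_strategies1_nonempty[OF s] local_strategies2_nonempty[OF s]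
  by (simp add: local_step_absorbing[OF assms] cong: SUP_cong_simp INF_cong_simp)

end

text \<open>A choice of Player 1 that is \<open>e\<close>-optimal for \<open>u\<close> guarantees,
  in the game with payoff \<open>v\<close>, at least the value for \<open>u\<close> minus
  \<open>e + d\<close>; then \<open>e\<close> tends to 0. The bound \<open>d\<close> may depend on
  \<open>s\<close>, which permits state-weighted estimates.\<close>

lemma bellman_diff_le:
  assumes u: "u \<in> states G \<rightarrow> {0..1}" and v: "v \<in> states G \<rightarrow> {0..1}"
    and s: "s \<in> states G"
    and le: "\<And>\<rho> \<sigma>. \<rho> \<in> local_strategies1 G s \<Longrightarrow> \<sigma> \<in> local_strategies2 G s \<Longrightarrow>
      step_value u s \<rho> \<sigma> \<le> step_value v s \<rho> \<sigma> + d"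
  shows "bellman G u s \<le> bellman G v s + d"
proof (rule field_le_epsilon)
  fix e :: real assume "e > 0"
  then obtain \<rho> where \<rho>: "\<rho> \<in> local_strategies1 G s"
    and *: "\<And>\<sigma>. \<sigma> \<in> local_strategies2 G s \<Longrightarrow> bellman G u s - e \<le> step_value u s \<rho> \<sigma>"
    using bellman_maximizer[OF u s] by blast
  have "bellman G u s - e - d \<le> bellman G v s"
    unfolding bellman_eq_step_value[OF s, of v]
    using step_value_range[OF s _ _ v] local_strategies2_nonempty[OF s] \<rho>
  proof (rule le_SUP_INF)
    fix \<sigma> assume "\<sigma> \<in> local_strategies2 G s"
    with *[of \<sigma>] le[OF \<rho>, of \<sigma>] show "bellman G u s - e - d \<le> step_value v s \<rho> \<sigma>" by simp
  qed
  then show "bellman G u s \<le> bellman G v s + d + e" by simp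
qed

section \<open>Bounds for the game value from reachability probabilities\<close>

lemma reach_prob_range: "reach_prob G \<rho> \<sigma> s \<in> {0..1}"
  using prob_space.prob_le_1[OF prob_space_mc_paths] by (auto simp: reach_prob_def)

lemma le_game_value:
  assumes "\<rho> \<in> strategies1 G" "\<And>\<sigma>. \<sigma> \<in> strategies2 G \<Longrightarrow> c \<le> reach_prob G \<rho> \<sigma> s"
  shows "c \<le> game_value G s"
  unfolding game_value_def
  by (rule le_SUP_INF) (use reach_prob_range strategies2_nonempty assms in blast)+

lemma game_value_le:
  assumes "\<And>\<rho>. \<rho> \<in> strategies1 G \<Longrightarrow> \<exists>\<sigma>\<in>strategies2 G. reach_prob G \<rho> \<sigma> s \<le> c"
  shows "game_value G s \<le> c"
  unfolding game_value_def
  by (rule SUP_INF_le) (use reach_prob_range strategies1_nonempty assms in blast)+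

lemma strategies_local:
  assumes "\<rho> \<in> strategies1 G" "\<sigma> \<in> strategies2 G" "x \<in> states G"
  shows "\<rho> x \<in> local_strategies1 G x" "\<sigma> x \<in> local_strategies2 G x"
  using assms by (auto simp: strategies1_def strategies2_def)

section \<open>Expectations along an induced chain\<close>

context
  fixes \<rho> \<sigma> and s :: 's
  assumes \<rho>: "\<rho> \<in> strategies1 G" and \<sigma>: "\<sigma> \<in> strategies2 G" and s: "s \<in> states G"
begin

lemma set_nstep: "set_pmf (nstep (induced_chain G \<rho> \<sigma>) s n) \<subseteq> states G"
proof (induction n)
  case (Suc n)
  then show ?case
    using set_local_step[OF _ strategies_local[OF \<rho> \<sigma>]] by (fastforce simp: induced_chain_eq_local_step)
qed (use s in simp)

lemma expectation_nstep_mono: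
  fixes u v :: "'s \<Rightarrow> real"
  assumes "\<And>x. x \<in> states G \<Longrightarrow> u x \<le> v x"
  shows "measure_pmf.expectation (nstep (induced_chain G \<rho> \<sigma>) s n) u \<le>
    measure_pmf.expectation (nstep (induced_chain G \<rho> \<sigma>) s n) v"
  using set_nstep[of n] finite_subset[OF set_nstep finite_states] assms
  by (intro integral_mono_AE integrable_measure_pmf_finite) (auto simp: AE_measure_pmf_iff)

lemma expectation_nstep_Suc:
  fixes u :: "'s \<Rightarrow> real"
  shows "measure_pmf.expectation (nstep (induced_chain G \<rho> \<sigma>) s (Suc n)) u =
    measure_pmf.expectation (nstep (induced_chain G \<rho> \<sigma>) s n) (\<lambda>x. step_value u x (\<rho> x) (\<sigma> x))"
proof -
  have "measure_pmf.expectation (nstep (induced_chain G \<rho> \<sigma>) s (Suc n)) u =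
      (\<Sum>x\<in>states G. pmf (nstep (induced_chain G \<rho> \<sigma>) s n) x *\<^sub>R step_value u x (\<rho> x) (\<sigma> x))"
    unfolding nstep.simps induced_chain_eq_local_step[symmetric]
    using finite_states set_nstep[of n] finite_subset[OF set_local_step[OF _ strategies_local[OF \<rho> \<sigma>]]]
    by (intro pmf_expectation_bind) (auto simp: induced_chain_eq_local_step)
  also have "\<dots> = measure_pmf.expectation (nstep (induced_chain G \<rho> \<sigma>) s n)
      (\<lambda>x. step_value u x (\<rho> x) (\<sigma> x))"
    using set_nstep[of n] by (subst integral_measure_pmf[OF finite_states]) auto
  finally show ?thesis .
qed

lemma expectation_nstep_submartingale:
  fixes u :: "'s \<Rightarrow> real"
  assumes "\<And>x. x \<in> states G \<Longrightarrow> u x \<le> step_value u x (\<rho> x) (\<sigma> x)"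
  shows "u s \<le> measure_pmf.expectation (nstep (induced_chain G \<rho> \<sigma>) s n) u"
proof (induction n)
  case (Suc n)
  also have "measure_pmf.expectation (nstep (induced_chain G \<rho> \<sigma>) s n) u \<le>
      measure_pmf.expectation (nstep (induced_chain G \<rho> \<sigma>) s (Suc n)) u"
    unfolding expectation_nstep_Suc by (rule expectation_nstep_mono) (rule assms)
  finally show ?case .
qed simp

text \<open>Iterates the one-step drift. A factor below 1 makes the potential vanish in mean; the
  factor 1 gives the supermartingale bound.\<close>

lemma expectation_nstep_geometric:
  fixes u :: "'s \<Rightarrow> real"
  assumes "\<And>x. x \<in> states G \<Longrightarrow> step_value u x (\<rho> x) (\<sigma> x) \<le> \<beta> * u x" "\<beta> \<ge> 0"
  shows "measure_pmf.expectation (nstep (induced_chain G \<rho> \<sigma>) s n) u \<le> \<beta> ^ n * u s"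
proof (induction n)
  case (Suc n)
  have "measure_pmf.expectation (nstep (induced_chain G \<rho> \<sigma>) s (Suc n)) u \<le>
      measure_pmf.expectation (nstep (induced_chain G \<rho> \<sigma>) s n) (\<lambda>x. \<beta> * u x)"
    unfolding expectation_nstep_Suc by (rule expectation_nstep_mono) (rule assms)
  also have "\<dots> \<le> \<beta> * (\<beta> ^ n * u s)"
    using mult_left_mono[OF Suc assms(2)] by simp
  finally show ?case by (simp add: mult.assoc)
qed simp

lemma nstep_tendsto_reach_prob:
  assumes "target G \<subseteq> states G" "\<And>t. t \<in> target G \<Longrightarrow> absorbing G t"
  shows "(\<lambda>n. measure_pmf.prob (nstep (induced_chain G \<rho> \<sigma>) s n) (target G)) \<longlonglongrightarrow> reach_prob G \<rho> \<sigma> s"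
  unfolding reach_prob_def using assms strategies_local[OF \<rho> \<sigma>]
  by (intro nstep_absorbing_tendsto_reach)
     (auto simp: induced_chain_eq_local_step intro!: local_step_absorbing)

end

end


section \<open>Games with a contracting potential\<close>

text \<open>The constant 1/2 ensures that \<open>2 * h\<close> is at least 1 outside
  \<open>{t, w}\<close>, so it dominates the difference of any two valuations there. At the
  absorbing states \<open>h_step\<close> reads \<open>h x \<le> \<beta> * h x\<close>, which forces
  \<open>h\<close> to vanish.\<close>

locale csg_potential = csg_game G for G :: "('s, 'a, 'b) csg" +
  fixes h :: "'s \<Rightarrow> real" and \<beta> :: real and t w :: 's
  assumes target: "target G = {t}" and zero: "zero_states G = {w}"
    and absorbing_t: "absorbing G t" and absorbing_w: "absorbing G w"
    and beta: "0 \<le> \<beta>" "\<beta> < 1"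
    and h_nonneg: "\<And>s. h s \<ge> 0"
    and h_ge: "\<And>s. s \<in> states G \<Longrightarrow> s \<noteq> t \<Longrightarrow> s \<noteq> w \<Longrightarrow> h s \<ge> 1/2"
    and h_step: "\<And>s \<rho> \<sigma>. s \<in> states G \<Longrightarrow> \<rho> \<in> local_strategies1 G s \<Longrightarrow>
      \<sigma> \<in> local_strategies2 G s \<Longrightarrow> step_value h s \<rho> \<sigma> \<le> \<beta> * h s"
begin

lemma t_in: "t \<in> states G"
  using wf target by (auto simp: wf_csg_def)

lemma w_in: "w \<in> states G"
  using zero by (auto simp: zero_states_def)

lemma reach_prob_target: "reach_prob G \<rho> \<sigma> t = 1"
proof -
  interpret prob_space "mc_paths (induced_chain G \<rho> \<sigma>) t"
    by (rule prob_space_mc_paths)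
  have "1 = prob {\<omega>. \<omega> 0 \<in> {t}}"
    by (simp only: measure_def emeasure_mc_paths_coordinate) simp
  also have "\<dots> \<le> reach_prob G \<rho> \<sigma> t"
    unfolding reach_prob_def target by (intro finite_measure_mono sets_reach_event) auto
  finally show ?thesis
    using reach_prob_range[of \<rho> \<sigma> t] by simp
qed

text \<open>A play from \<open>t\<close> starts in the target, so its value is 1, while
  \<open>w\<close> has value 0.\<close>

lemma t_neq_w: "t \<noteq> w"
proof
  assume "t = w"
  then have "game_value G t = 0"
    using zero by (auto simp: zero_states_def)
  moreover obtain \<rho> where "\<rho> \<in> strategies1 G"
    using strategies1_nonempty by auto
  then have "1 \<le> game_value G t"
    by (rule le_game_value) (simp add: reach_prob_target)
  ultimately show False by simp
qed

context
  fixes \<rho> \<sigma> s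
  assumes \<rho>: "\<rho> \<in> strategies1 G" and \<sigma>: "\<sigma> \<in> strategies2 G" and s: "s \<in> states G"
begin

abbreviation mean where "mean n \<equiv> measure_pmf.expectation (nstep (induced_chain G \<rho> \<sigma>) s n)"

lemma mean_indicator_tendsto: "(\<lambda>n. mean n (indicator {t})) \<longlonglongrightarrow> reach_prob G \<rho> \<sigma> s"
  using nstep_tendsto_reach_prob[OF \<rho> \<sigma> s] t_in absorbing_t by (simp add: target)

lemma mean_add_mult:
  fixes f g :: "'s \<Rightarrow> real"
  shows "mean n (\<lambda>x. f x + d * g x) = mean n f + d * mean n g"
proof -
  have "finite (set_pmf (nstep (induced_chain G \<rho> \<sigma>) s n))"
    using set_nstep[OF \<rho> \<sigma> s] finite_states by (rule finite_subset)
  then show ?thesis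
    by (simp add: integrable_measure_pmf_finite)
qed

text \<open>As \<open>h\<close> is at least 1/2 outside \<open>{t, w}\<close>, this says that the
  probability of still being outside decays geometrically, whatever the strategies.\<close>

lemma mean_h_le: "mean n h \<le> \<beta> ^ n * h s"
  using expectation_nstep_geometric[OF \<rho> \<sigma> s, of h \<beta>] beta h_step strategies_local[OF \<rho> \<sigma>] by blast

section \<open>Reachability bounds from almost invariant valuations\<close>

context
  fixes v :: "'s \<Rightarrow> real" and c :: real
  assumes v: "v \<in> states G \<rightarrow> {0..1}" and vt: "v t = 1" and vw: "v w = 0" and c: "c \<ge> 0"
begin

text \<open>The one-step loss \<open>c * h\<close> is paid for by the drift of \<open>d * h\<close>,
  so \<open>v - d * h\<close> is a submartingale. It lies below
  \<open>indicator {t} + 2 * h\<close>, whose mean tends to the reachability probability.\<close>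

lemma le_reach_prob_if_subinvariant:
  assumes sub: "\<And>x. x \<in> states G \<Longrightarrow> v x \<le> step_value v x (\<rho> x) (\<sigma> x) + c * h x"
  shows "v s \<le> reach_prob G \<rho> \<sigma> s + c / (1 - \<beta>) * h s"
proof -
  \<comment> \<open>The solution of \<open>d = c + d * \<beta>\<close>: the total of the one-step
    errors \<open>c * \<beta> ^ n\<close>.\<close>
  define d where "d = c / (1 - \<beta>)"
  have "d * (1 - \<beta>) = c"
    using beta by (simp add: d_def)
  then have d: "d \<ge> 0" "c = d - d * \<beta>"
    using beta c by (auto simp: d_def right_diff_distrib)
  let ?u = "\<lambda>x. v x + (- d) * h x"
  have "?u x \<le> step_value ?u x (\<rho> x) (\<sigma> x)" if x: "x \<in> states G" for x
  proof -
    note loc = x strategies_local[OF \<rho> \<sigma> x]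
    have "d * step_value h x (\<rho> x) (\<sigma> x) \<le> d * (\<beta> * h x)"
      using h_step[OF loc] d by (intro mult_left_mono) auto
    with sub[OF x] show ?thesis
      unfolding step_value_add_mult[OF loc] by (simp add: d(2) algebra_simps)
  qed
  then have "?u s \<le> mean n ?u" for n
    by (rule expectation_nstep_submartingale[OF \<rho> \<sigma> s])
  moreover have "mean n ?u \<le> mean n (indicator {t}) + 2 * (\<beta> ^ n * h s)" for n
  proof -
    have "mean n ?u \<le> mean n (\<lambda>x. indicator {t} x + 2 * h x)"
    proof (rule expectation_nstep_mono[OF \<rho> \<sigma> s])
      fix x assume x: "x \<in> states G"
      \<comment> \<open>At \<open>t\<close> the indicator is 1, at \<open>w\<close> the valuation is
        0, and elsewhere \<open>2 * h x\<close> is at least 1.\<close>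
      have "v x \<le> indicator {t} x + 2 * h x"
        using h_ge[OF x] h_nonneg[of x] vw vt v x by (cases "x = t"; cases "x = w") (auto simp: Pi_iff)
      moreover have "d * h x \<ge> 0"
        using d h_nonneg by simp
      ultimately show "?u x \<le> indicator {t} x + 2 * h x" by simp
    qed
    also have "\<dots> \<le> mean n (indicator {t}) + 2 * (\<beta> ^ n * h s)"
      unfolding mean_add_mult using mean_h_le[of n] by simp
    finally show ?thesis .
  qed
  ultimately have le: "?u s \<le> mean n (indicator {t}) + 2 * (\<beta> ^ n * h s)" for n
    by (rule order_trans)
  have "(\<lambda>n. mean n (indicator {t}) + 2 * (\<beta> ^ n * h s)) \<longlonglongrightarrow> reach_prob G \<rho> \<sigma> s + 2 * (0 * h s)"
    using beta by (intro tendsto_intros mean_indicator_tendsto LIMSEQ_power_zero) auto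
  then have "?u s \<le> reach_prob G \<rho> \<sigma> s + 2 * (0 * h s)"
    by (rule LIMSEQ_le_const) (use le in auto)
  then show ?thesis by (simp add: d_def)
qed

text \<open>Dually, \<open>v + d * h\<close> is a supermartingale. It dominates the indicator of
  \<open>t\<close> at once, since \<open>v t = 1\<close> and both summands are nonnegative.\<close>

lemma reach_prob_le_if_superinvariant:
  assumes super: "\<And>x. x \<in> states G \<Longrightarrow> step_value v x (\<rho> x) (\<sigma> x) \<le> v x + c * h x"
  shows "reach_prob G \<rho> \<sigma> s \<le> v s + c / (1 - \<beta>) * h s"
proof -
  define d where "d = c / (1 - \<beta>)"
  have "d * (1 - \<beta>) = c"
    using beta by (simp add: d_def)
  then have d: "d \<ge> 0" "c = d - d * \<beta>"
    using beta c by (auto simp: d_def right_diff_distrib)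
  let ?u = "\<lambda>x. v x + d * h x"
  have "step_value ?u x (\<rho> x) (\<sigma> x) \<le> 1 * ?u x" if x: "x \<in> states G" for x
  proof -
    note loc = x strategies_local[OF \<rho> \<sigma> x]
    have "d * step_value h x (\<rho> x) (\<sigma> x) \<le> d * (\<beta> * h x)"
      using h_step[OF loc] d by (intro mult_left_mono) auto
    with super[OF x] show ?thesis
      unfolding step_value_add_mult[OF loc] by (simp add: d(2) algebra_simps)
  qed
  then have "mean n ?u \<le> ?u s" for n
    using expectation_nstep_geometric[OF \<rho> \<sigma> s, of ?u 1 n] by simp
  moreover have "mean n (indicator {t}) \<le> mean n ?u" for n
  proof (rule expectation_nstep_mono[OF \<rho> \<sigma> s])
    fix x assume x: "x \<in> states G"
    have "d * h x \<ge> 0"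
      using d h_nonneg by simp
    then show "indicator {t} x \<le> ?u x"
      using v x vt by (auto simp: Pi_iff split: split_indicator)
  qed
  ultimately have le: "mean n (indicator {t}) \<le> ?u s" for n
    using order_trans by blast
  show ?thesis
    unfolding d_def[symmetric]
    by (rule LIMSEQ_le_const2[OF mean_indicator_tendsto]) (use le in auto)
qed

end

end

section \<open>The over-approximations and their rate of convergence\<close>

lemma over_approx_range: "over_approx G k \<in> states G \<rightarrow> {0..1}"
proof (induction k)
  case (Suc k)
  then show ?case
    using bellman_range[OF Suc] by auto
qed auto

lemma over_approx_target: "over_approx G k t = 1"
  using t_neq_w by (induction k) (simp_all add: zero bellman_absorbing[OF over_approx_range t_in absorbing_t])

lemma over_approx_zero: "over_approx G k w = 0"
  by (induction k) (simp_all add: zero bellman_absorbing[OF over_approx_range w_in absorbing_w])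

text \<open>A one-sided contraction in the distance weighted by \<open>h\<close>: by
  \<open>h_step\<close>, an error \<open>c * h\<close> shrinks by the factor \<open>\<beta>\<close>
  under every local pair, hence also after the supremum and infimum.\<close>

lemma bellman_contraction:
  assumes u: "u \<in> states G \<rightarrow> {0..1}" and v: "v \<in> states G \<rightarrow> {0..1}" and c: "c \<ge> 0"
    and le: "\<And>x. x \<in> states G \<Longrightarrow> u x \<le> v x + c * h x" and s: "s \<in> states G"
  shows "bellman G u s \<le> bellman G v s + c * \<beta> * h s"
proof (rule bellman_diff_le[OF u v s])
  fix \<rho> \<sigma> assume loc: "\<rho> \<in> local_strategies1 G s" "\<sigma> \<in> local_strategies2 G s"
  have "step_value u s \<rho> \<sigma> \<le> step_value (\<lambda>x. v x + c * h x) s \<rho> \<sigma>"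
    using le by (rule step_value_mono[OF s loc])
  also have "\<dots> \<le> step_value v s \<rho> \<sigma> + c * (\<beta> * h s)"
    unfolding step_value_add_mult[OF s loc] using c h_step[OF s loc] by (simp add: mult_left_mono)
  finally show "step_value u s \<rho> \<sigma> \<le> step_value v s \<rho> \<sigma> + c * \<beta> * h s"
    by (simp add: mult.assoc)
qed

text \<open>Initially the two iterates agree at \<open>t\<close> and \<open>w\<close>, and elsewhere
  differ by at most 1, hence by at most \<open>2 * h\<close>. Both directions are carried along
  because the contraction is one-sided.\<close>

lemma over_approx_Suc_diff:
  assumes "s \<in> states G"
  shows "over_approx G (Suc k) s \<le> over_approx G k s + 2 * \<beta> ^ k * h s \<and>
    over_approx G k s \<le> over_approx G (Suc k) s + 2 * \<beta> ^ k * h s"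
  using assms
proof (induction k arbitrary: s)
  case 0
  show ?case
  proof (cases "s = t \<or> s = w")
    case True
    then show ?thesis
      using over_approx_target[of 0] over_approx_target[of "Suc 0"] over_approx_zero[of 0]
        over_approx_zero[of "Suc 0"] h_nonneg[of s] by auto
  next
    case False
    have "over_approx G 0 s \<in> {0..1}" "over_approx G (Suc 0) s \<in> {0..1}"
      using over_approx_range 0 by blast+
    with h_ge[OF 0] False show ?thesis by auto
  qed
next
  case (Suc k)
  then show ?case
    using bellman_contraction[OF over_approx_range over_approx_range, of "2 * \<beta> ^ k" k "Suc k" s]
      bellman_contraction[OF over_approx_range over_approx_range, of "2 * \<beta> ^ k" "Suc k" k s] beta
    by (simp add: mult_ac)
qed

lemma over_approx_le_game_value:
  assumes s: "s \<in> states G" and e: "e > 0"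
  shows "over_approx G k s \<le> game_value G s + (2 * \<beta> ^ k + e) / (1 - \<beta>) * h s"
proof -
  let ?U = "over_approx G k"
  \<comment> \<open>The slack \<open>e / 2\<close> is chosen so that outside \<open>{t, w}\<close>,
    where \<open>h\<close> is at least 1/2, it is at most \<open>e * h\<close>.\<close>
  have "\<forall>x\<in>states G. \<exists>\<rho>. \<rho> \<in> local_strategies1 G x \<and>
      (\<forall>\<sigma>\<in>local_strategies2 G x. bellman G ?U x - e / 2 \<le> step_value ?U x \<rho> \<sigma>)"
    using bellman_maximizer[OF over_approx_range] e by (simp add: Bex_def)
  then obtain \<rho> where \<rho>: "\<And>x. x \<in> states G \<Longrightarrow> \<rho> x \<in> local_strategies1 G x"
    and opt: "\<And>x \<sigma>. x \<in> states G \<Longrightarrow> \<sigma> \<in> local_strategies2 G x \<Longrightarrow>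
      bellman G ?U x - e / 2 \<le> step_value ?U x (\<rho> x) \<sigma>"
    by metis
  have str: "\<rho> \<in> strategies1 G"
    using \<rho> by (simp add: strategies1_def)
  have "?U s - (2 * \<beta> ^ k + e) / (1 - \<beta>) * h s \<le> game_value G s"
  proof (rule le_game_value[OF str])
    fix \<sigma> assume \<sigma>: "\<sigma> \<in> strategies2 G"
    have "?U x \<le> step_value ?U x (\<rho> x) (\<sigma> x) + (2 * \<beta> ^ k + e) * h x" if x: "x \<in> states G" for x
    \<comment> \<open>At \<open>t\<close> and \<open>w\<close> the potential vanishes and offers no
      slack for \<open>e / 2\<close>; there the chain stays put and the inequality is exact.\<close>
    proof (cases "x = t \<or> x = w")
      case True
      then have "local_step G x (\<rho> x) (\<sigma> x) = return_pmf x"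
        using absorbing_t absorbing_w by (intro local_step_absorbing strategies_local[OF str \<sigma> x]) auto
      then show ?thesis
        using h_nonneg beta e by simp
    next
      case False
      then have "e / 2 \<le> e * h x"
        using h_ge[OF x] e by (simp add: field_simps)
      moreover have "bellman G ?U x - e / 2 \<le> step_value ?U x (\<rho> x) (\<sigma> x)"
        using opt[OF x] strategies_local[OF str \<sigma> x] by simp
      moreover have "?U x \<le> bellman G ?U x + 2 * \<beta> ^ k * h x"
        using over_approx_Suc_diff[OF x, of k] by simp
      ultimately show ?thesis by (simp add: algebra_simps)
    qed
    then show "?U s - (2 * \<beta> ^ k + e) / (1 - \<beta>) * h s \<le> reach_prob G \<rho> \<sigma> s"
      using le_reach_prob_if_subinvariant[OF str \<sigma> s over_approx_range over_approx_target
          over_approx_zero, of "2 * \<beta> ^ k + e" k] beta e by (simp add: algebra_simps)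
  qed
  then show ?thesis by simp
qed

text \<open>In a supremum of infima Player 2 replies to a known \<rho>, so the near-optimal local
  replies may depend on it; chosen state by state they form one memoryless strategy.\<close>

lemma game_value_le_over_approx:
  assumes s: "s \<in> states G" and e: "e > 0"
  shows "game_value G s \<le> over_approx G k s + (2 * \<beta> ^ k + e) / (1 - \<beta>) * h s"
proof (rule game_value_le)
  let ?U = "over_approx G k"
  fix \<rho> assume str: "\<rho> \<in> strategies1 G"
  then have "\<forall>x\<in>states G. \<rho> x \<in> local_strategies1 G x"
    by (simp add: strategies1_def)
  then have "\<forall>x\<in>states G. \<exists>\<sigma>. \<sigma> \<in> local_strategies2 G x \<and>
      step_value ?U x (\<rho> x) \<sigma> \<le> bellman G ?U x + e / 2"
    using bellman_response[OF over_approx_range _ half_gt_zero[OF e]] by (simp add: Bex_def)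
  then obtain \<sigma> where \<sigma>: "\<And>x. x \<in> states G \<Longrightarrow> \<sigma> x \<in> local_strategies2 G x"
    and opt: "\<And>x. x \<in> states G \<Longrightarrow> step_value ?U x (\<rho> x) (\<sigma> x) \<le> bellman G ?U x + e / 2"
    by metis
  have str2: "\<sigma> \<in> strategies2 G"
    using \<sigma> by (simp add: strategies2_def)
  have "step_value ?U x (\<rho> x) (\<sigma> x) \<le> ?U x + (2 * \<beta> ^ k + e) * h x" if x: "x \<in> states G" for x
  proof (cases "x = t \<or> x = w")
    case True
    then have "local_step G x (\<rho> x) (\<sigma> x) = return_pmf x"
      using absorbing_t absorbing_w by (intro local_step_absorbing strategies_local[OF str str2 x]) auto
    then show ?thesis
      using h_nonneg beta e by simp
  next
    case False
    then have "e / 2 \<le> e * h x"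
      using h_ge[OF x] e by (simp add: field_simps)
    moreover have "bellman G ?U x \<le> ?U x + 2 * \<beta> ^ k * h x"
      using over_approx_Suc_diff[OF x, of k] by simp
    ultimately show ?thesis
      using opt[OF x] by (simp add: algebra_simps)
  qed
  then have "reach_prob G \<rho> \<sigma> s \<le> ?U s + (2 * \<beta> ^ k + e) / (1 - \<beta>) * h s"
    using beta e by (intro reach_prob_le_if_superinvariant[OF str str2 s over_approx_range
          over_approx_target over_approx_zero]) auto
  with str2 show "\<exists>\<sigma>\<in>strategies2 G. reach_prob G \<rho> \<sigma> s \<le> ?U s + (2 * \<beta> ^ k + e) / (1 - \<beta>) * h s"
    by blast
qed

lemma over_approx_tendsto_game_value:
  assumes s: "s \<in> states G"
  shows "(\<lambda>k. over_approx G k s) \<longlonglongrightarrow> game_value G s"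
proof -
  \<comment> \<open>The error \<open>e\<close> of the two preceding lemmas is taken as
    \<open>(1 / 2) ^ k\<close>, so that it vanishes together with
    \<open>\<beta> ^ k\<close>.\<close>
  let ?r = "\<lambda>k. (2 * \<beta> ^ k + (1 / 2) ^ k) / (1 - \<beta>) * h s"
  have "?r \<longlonglongrightarrow> (2 * 0 + 0) / (1 - \<beta>) * h s"
    using beta by (intro tendsto_intros LIMSEQ_power_zero) auto
  then have "?r \<longlonglongrightarrow> 0"
    by simp
  moreover have "norm (over_approx G k s - game_value G s) \<le> ?r k" for k
    using over_approx_le_game_value[OF s, of "(1 / 2) ^ k" k]
      game_value_le_over_approx[OF s, of "(1 / 2) ^ k" k] by (simp add: abs_le_iff)
  then have "\<forall>\<^sub>F k in sequentially. norm (over_approx G k s - game_value G s) \<le> ?r k"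
    by (intro always_eventually allI)
  ultimately have "(\<lambda>k. over_approx G k s - game_value G s) \<longlonglongrightarrow> 0"
    by (rule Lim_null_comparison[rotated])
  then show ?thesis
    by (simp add: LIM_zero_iff)
qed

end

section \<open>Ranks from trivial end components\<close>

context csg_game
begin

text \<open>Fixing one pair of actions per state turns \<open>Y\<close> into a finite graph closed
  under successors. A reachable set of least cardinality in it is a bottom strongly connected
  component.\<close>

lemma end_component_in_closed_set:
  assumes Y: "Y \<noteq> {}" "Y \<subseteq> states G"
    and act: "\<And>s. s \<in> Y \<Longrightarrow> a s \<in> enabled1 G s" "\<And>s. s \<in> Y \<Longrightarrow> b s \<in> enabled2 G s"
    and closed: "\<And>s. s \<in> Y \<Longrightarrow> set_pmf (transition G s (a s) (b s)) \<subseteq> Y"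
  shows "\<exists>X\<subseteq>Y. end_component G X"
proof -
  define R where "R = {(u, v). u \<in> Y \<and> v \<in> set_pmf (transition G u (a u) (b u))}"
  let ?C = "\<lambda>s. R\<^sup>* `` {s}"
  have C_sub: "?C s \<subseteq> Y" if "s \<in> Y" for s
  proof -
    have "v \<in> Y" if "(s, v) \<in> R\<^sup>*" for v
      using that by (induction rule: rtrancl_induct) (use \<open>s \<in> Y\<close> closed in \<open>auto simp: R_def\<close>)
    then show ?thesis by auto
  qed
  obtain s where s: "s \<in> Y" and min: "\<And>y. y \<in> Y \<Longrightarrow> card (?C s) \<le> card (?C y)"
    using ex_has_least_nat[of "\<lambda>s. s \<in> Y" _ "\<lambda>s. card (?C s)"] Y(1) by blast
  define X where "X = ?C s"
  have XY: "X \<subseteq> Y" and sX: "s \<in> X"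
    using C_sub[OF s] by (auto simp: X_def)
  have finX: "finite X"
    using XY Y(2) finite_states by (meson finite_subset)
  \<comment> \<open>What \<open>u\<close> reaches lies in \<open>X\<close>, and minimality of the
    cardinality forces equality. So each state of \<open>X\<close> reaches all of \<open>X\<close>
    and nothing else.\<close>
  have C_eq: "?C u = X" if u: "u \<in> X" for u
  proof (rule card_subset_eq[OF finX])
    show sub: "?C u \<subseteq> X"
      using u by (auto simp: X_def)
    show "card (?C u) = card X"
      using card_mono[OF finX sub] min[of u] u XY by (simp add: X_def subset_iff)
  qed
  let ?P = "\<lambda>u. post G u (return_pmf (a u)) (return_pmf (b u))"
  have path: "(u, v) \<in> {(u, v). u \<in> X \<and> v \<in> ?P u}\<^sup>*" if "(u, v) \<in> R\<^sup>*" "u \<in> X" for u v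
    using that
  proof (induction rule: converse_rtrancl_induct)
    case (step u y)
    then have "y \<in> X"
      using C_eq[of u] by auto
    moreover have "y \<in> ?P u"
      using step.hyps(1) by (simp add: R_def post_def)
    ultimately show ?case
      using step by (intro converse_rtrancl_into_rtrancl[of u y]) auto
  qed simp
  have "end_component G X"
    unfolding end_component_def
  proof (intro conjI exI[of _ "\<lambda>u. return_pmf (a u)"] exI[of _ "\<lambda>u. return_pmf (b u)"] ballI)
    show "X \<noteq> {}" "X \<subseteq> states G"
      using sX XY Y(2) by auto
    fix u assume u: "u \<in> X"
    then have "u \<in> Y" using XY by auto
    then show "return_pmf (a u) \<in> local_strategies1 G u" "return_pmf (b u) \<in> local_strategies2 G u"
      using act by (auto simp: local_strategies1_def local_strategies2_def)
    have "v \<in> ?C u" if "v \<in> ?P u" for v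
      using that \<open>u \<in> Y\<close> by (auto simp: post_def R_def)
    then show "?P u \<subseteq> X"
      using C_eq[OF u] by blast
    fix v assume "v \<in> X"
    then show "(u, v) \<in> {(u, v). u \<in> X \<and> v \<in> ?P u}\<^sup>*"
      using C_eq[OF u] u by (intro path) auto
  qed
  with XY show ?thesis by blast
qed

text \<open>A maximal set \<open>A\<close> that can be ranked is all of \<open>states G\<close>.
  Otherwise every state outside \<open>A\<close> has a pair of actions that avoids \<open>A\<close>,
  since it could be added to \<open>A\<close> if all pairs had a successor there. These pairs keep
  the play outside \<open>A\<close>, where an end component would then exist, contrary to
  \<open>ec\<close>.\<close>

lemma decreasing_rank_exists:
  fixes Z :: "'s set"
  assumes Z: "Z \<subseteq> states G" and ec: "\<And>E. end_component G E \<Longrightarrow> E \<subseteq> Z"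
  shows "\<exists>r :: 's \<Rightarrow> nat. (\<forall>s. r s = 0 \<longleftrightarrow> s \<in> Z) \<and> (\<forall>s\<in>states G - Z. \<forall>a\<in>enabled1 G s. \<forall>b\<in>enabled2 G s.
    \<exists>s'\<in>set_pmf (transition G s a b). r s' < r s)"
proof -
  \<comment> \<open>Successors of smaller rank must lie in \<open>A\<close>, so changing the rank of
    a state outside \<open>A\<close> does not disturb them.\<close>
  define ranked where "ranked A r \<longleftrightarrow> (\<forall>s. r s = 0 \<longleftrightarrow> s \<in> Z) \<and> (\<forall>s\<in>A - Z. \<forall>a\<in>enabled1 G s. \<forall>b\<in>enabled2 G s.
    \<exists>s'\<in>set_pmf (transition G s a b) \<inter> A. r s' < r s)" for A and r :: "'s \<Rightarrow> nat"
  let ?F = "{A. Z \<subseteq> A \<and> A \<subseteq> states G \<and> (\<exists>r. ranked A r)}"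
  have "ranked Z (\<lambda>s. if s \<in> Z then 0 else 1)"
    by (auto simp: ranked_def)
  then have "Z \<in> ?F"
    using Z by auto
  moreover have "finite ?F"
    using finite_states by (rule rev_finite_subset[OF finite_Pow_iff[THEN iffD2]]) auto
  ultimately have "\<exists>A\<in>?F. \<forall>B\<in>?F. A \<subseteq> B \<longrightarrow> A = B"
    by (intro finite_has_maximal) auto
  then obtain A where A: "A \<in> ?F" and max: "\<forall>B\<in>?F. A \<subseteq> B \<longrightarrow> A = B"
    by (elim bexE)
  from A obtain r where r: "ranked A r" and ZA: "Z \<subseteq> A" and AS: "A \<subseteq> states G"
    by auto
  have "\<exists>a\<in>enabled1 G s. \<exists>b\<in>enabled2 G s. set_pmf (transition G s a b) \<inter> A = {}"
    if s: "s \<in> states G - A" for s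
  proof (rule ccontr)
    assume no: "\<not> ?thesis"
    \<comment> \<open>The new rank exceeds all ranks in \<open>A\<close>. \<open>insert 0\<close>
      covers an empty \<open>A\<close>, and \<open>Suc\<close> keeps the rank of \<open>s\<close>,
      which is not in \<open>Z\<close>, nonzero.\<close>
    define r' where "r' = r(s := Suc (Max (insert 0 (r ` A))))"
    have finA: "finite A"
      using AS finite_states by (rule finite_subset)
    have lt: "r' x < r' s" if "x \<in> A" for x
      using that s finA by (auto simp: r'_def less_Suc_eq_le intro!: Max_ge)
    have "ranked (insert s A) r'"
      unfolding ranked_def
    proof (intro conjI ballI allI)
      show "r' x = 0 \<longleftrightarrow> x \<in> Z" for x
        using r s ZA by (auto simp: r'_def ranked_def)
      fix x a b assume x: "x \<in> insert s A - Z" and ab: "a \<in> enabled1 G x" "b \<in> enabled2 G x"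
      show "\<exists>s'\<in>set_pmf (transition G x a b) \<inter> insert s A. r' s' < r' x"
      proof (cases "x = s")
        case True
        then show ?thesis
          using no ab lt by blast
      next
        case False
        then obtain y where "y \<in> set_pmf (transition G x a b) \<inter> A" "r y < r x"
          using r x ab unfolding ranked_def by blast
        then show ?thesis
          using False s by (intro bexI[of _ y]) (auto simp: r'_def)
      qed
    qed
    then have "insert s A \<in> ?F"
      using s AS ZA by auto
    then show False
      using bspec[OF max, of "insert s A"] s by auto
  qed
  then obtain a b where ab: "\<And>s. s \<in> states G - A \<Longrightarrow> a s \<in> enabled1 G s"
      "\<And>s. s \<in> states G - A \<Longrightarrow> b s \<in> enabled2 G s"
      "\<And>s. s \<in> states G - A \<Longrightarrow> set_pmf (transition G s (a s) (b s)) \<inter> A = {}"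
    by metis
  have "states G - A = {}"
  proof (rule ccontr)
    assume "states G - A \<noteq> {}"
    moreover have "set_pmf (transition G s (a s) (b s)) \<subseteq> states G - A" if "s \<in> states G - A" for s
      using set_transition[of s "a s" "b s"] ab[OF that] that by auto
    ultimately obtain X where X: "X \<subseteq> states G - A" "end_component G X"
      using end_component_in_closed_set[of "states G - A" a b] ab(1,2) by auto
    with ec ZA have "X = {}" by blast
    with X(2) show False by (simp add: end_component_def)
  qed
  with AS have "A = states G" by auto
  with r show ?thesis
    unfolding ranked_def by (intro exI[of _ r]) (auto dest!: bspec)
qed

lemma min_transition_prob:
  "\<exists>p>0. p \<le> 1 \<and> (\<forall>s\<in>states G. \<forall>a\<in>enabled1 G s. \<forall>b\<in>enabled2 G s.
     \<forall>s'\<in>set_pmf (transition G s a b). p \<le> pmf (transition G s a b) s')"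
proof -
  \<comment> \<open>The element 1 makes the set nonempty and its minimum at most 1.\<close>
  let ?Q = "insert 1 (\<Union>s\<in>states G. \<Union>a\<in>enabled1 G s. \<Union>b\<in>enabled2 G s.
    pmf (transition G s a b) ` set_pmf (transition G s a b))"
  have fin: "finite ?Q"
    using finite_states finite_enabled1 finite_enabled2 finite_transition by auto
  have "Min ?Q > 0"
    using fin by (subst Min_gr_iff) (auto simp: pmf_positive)
  moreover have "Min ?Q \<le> 1"
    using fin by (intro Min_le) auto
  moreover have "Min ?Q \<le> pmf (transition G s a b) s'"
    if "s \<in> states G" "a \<in> enabled1 G s" "b \<in> enabled2 G s" "s' \<in> set_pmf (transition G s a b)" for s a b s'
    using fin that by (intro Min_le) auto
  ultimately show ?thesis by blast
qed

end

section \<open>The potential obtained from the ranks\<close>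

theorem theorem9:
  fixes G :: "('s, 'a, 'b) csg"
  assumes "wf_csg G"
    and "is_singleton (target G)" and "\<forall>s\<in>target G. absorbing G s"
    and "is_singleton (zero_states G)" and "\<forall>s\<in>zero_states G. absorbing G s"
    and "\<forall>E. end_component G E \<longrightarrow> E \<subseteq> zero_states G \<union> target G"
  shows "\<forall>s\<in>states G. (\<lambda>k. over_approx G k s) \<longlonglongrightarrow> game_value G s"
proof -
  interpret csg_game G
    using assms(1) by unfold_locales
  obtain t w where tw: "target G = {t}" "zero_states G = {w}"
    using assms(2,4) by (auto simp: is_singleton_def)
  have abs: "absorbing G x" if "x \<in> {t, w}" for x
    using assms(3,5) tw that by auto
  have "{t, w} \<subseteq> states G"
    using tw assms(1) by (auto simp: wf_csg_def zero_states_def)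
  moreover have "E \<subseteq> {t, w}" if "end_component G E" for E
    using assms(6) tw that by auto
  ultimately obtain r :: "'s \<Rightarrow> nat" where r0: "\<And>s. r s = 0 \<longleftrightarrow> s \<in> {t, w}"
    and r: "\<And>s a b. s \<in> states G \<Longrightarrow> s \<notin> {t, w} \<Longrightarrow> a \<in> enabled1 G s \<Longrightarrow> b \<in> enabled2 G s \<Longrightarrow>
      \<exists>s'\<in>set_pmf (transition G s a b). r s' < r s"
    using decreasing_rank_exists[of "{t, w}"] by (metis DiffI)
  obtain p where p: "p > 0" "p \<le> 1" and p_le: "\<And>s a b s'. s \<in> states G \<Longrightarrow> a \<in> enabled1 G s \<Longrightarrow>
      b \<in> enabled2 G s \<Longrightarrow> s' \<in> set_pmf (transition G s a b) \<Longrightarrow> p \<le> pmf (transition G s a b) s'"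
    using min_transition_prob by metis
  \<comment> \<open>With this choice a successor of rank one less, reached with probability at least
    \<open>p\<close>, contributes \<open>p * q ^ (n - 1) = 2 * q ^ n\<close> for
    \<open>n > 0\<close>: the mean of \<open>q ^ r\<close> at least doubles.\<close>
  define q where "q = p / 2"
  have q: "0 < q" "q \<le> 1 / 2" "q \<le> 1" "p = 2 * q"
    using p by (auto simp: q_def)
  define N where "N = Max (r ` states G)"
  define h where "h s = 1 - q ^ r s" for s
  \<comment> \<open>The contraction factor at \<open>s\<close> is \<open>1 - q ^ r s\<close>; it is
    worst at the largest rank \<open>N\<close>.\<close>
  define \<beta> where "\<beta> = 1 - q ^ N"
  have pow: "0 < q ^ n" "q ^ n \<le> 1" for n
    using q by (auto intro: power_le_one)
  have h01: "0 \<le> h s" "h s \<le> 1" for s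
    using pow[of "r s"] by (auto simp: h_def)
  have h_action: "measure_pmf.expectation (transition G s a b) h \<le> \<beta> * h s"
    if s: "s \<in> states G" "s \<notin> {t, w}" and ab: "a \<in> enabled1 G s" "b \<in> enabled2 G s" for s a b
  proof -
    let ?M = "transition G s a b"
    obtain y where y: "y \<in> set_pmf ?M" "r y < r s"
      using r[OF s ab] by blast
    have int: "integrable ?M f" for f :: "'s \<Rightarrow> real"
      using finite_transition[OF s(1) ab] by (rule integrable_measure_pmf_finite)
    have "q * q ^ r y \<ge> q ^ r s"
      using power_decreasing[of "Suc (r y)" "r s" q] y q by simp
    then have "2 * q ^ r s \<le> p * q ^ r y"
      using q by simp
    also have "\<dots> \<le> pmf ?M y * q ^ r y"
      using p_le[OF s(1) ab y(1)] pow[of "r y"] by (intro mult_right_mono) auto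
    also have "\<dots> = measure_pmf.expectation ?M (\<lambda>x. indicator {y} x * q ^ r y)"
      by (simp add: measure_pmf_single)
    \<comment> \<open>Only the contribution of \<open>y\<close> is kept; all others are
      nonnegative.\<close>
    also have "\<dots> \<le> measure_pmf.expectation ?M (\<lambda>x. q ^ r x)"
      using pow by (intro integral_mono int) (auto simp: less_imp_le split: split_indicator)
    finally have "measure_pmf.expectation ?M h \<le> 1 - 2 * q ^ r s"
      unfolding h_def using int by simp
    \<comment> \<open>With \<open>x = q ^ r s\<close> this is
      \<open>1 - 2 * x \<le> (1 - x)^2\<close>.\<close>
    also have "\<dots> \<le> (1 - q ^ r s) * h s"
      using pow[of "r s"] by (simp add: h_def algebra_simps)
    also have "\<dots> \<le> \<beta> * h s"
    proof (rule mult_right_mono)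
      have "r s \<le> N"
        unfolding N_def using s finite_states by (intro Max_ge) auto
      then show "1 - q ^ r s \<le> \<beta>"
        using power_decreasing[of "r s" N q] q by (simp add: \<beta>_def)
    qed (rule h01)
    finally show ?thesis .
  qed
  interpret csg_potential G h \<beta> t w
  proof
    show "target G = {t}" "zero_states G = {w}" "absorbing G t" "absorbing G w"
      using tw abs by auto
    show "0 \<le> \<beta>" "\<beta> < 1"
      using pow[of N] by (auto simp: \<beta>_def)
    show "h s \<ge> 0" for s
      by (rule h01)
    show "h s \<ge> 1 / 2" if "s \<noteq> t" "s \<noteq> w" for s
    proof -
      \<comment> \<open>A positive rank gives \<open>q ^ r s \<le> q\<close>, and \<open>q\<close>
        is at most 1/2.\<close>
      have "r s \<noteq> 0" using r0[of s] that by auto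
      then have "q ^ r s \<le> q ^ 1"
        using q by (intro power_decreasing) auto
      then show ?thesis using q by (simp add: h_def)
    qed
    show "step_value h s \<rho> \<sigma> \<le> \<beta> * h s"
      if s: "s \<in> states G" and loc: "\<rho> \<in> local_strategies1 G s" "\<sigma> \<in> local_strategies2 G s" for s \<rho> \<sigma>
    proof (cases "s \<in> {t, w}")
      case True
      then have "h s = 0"
        using r0[of s] by (simp add: h_def)
      then show ?thesis
        using local_step_absorbing[OF abs[OF True] loc] by simp
    next
      case False
      then show ?thesis
        using s by (intro step_value_le_of_actions[OF s loc] h_action) auto
    qed
  qed
  show ?thesis
    using over_approx_tendsto_game_value by blast
qed

end
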